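(* Let $\sigma>0$, $\varepsilon>0$, $\Delta x>0$, $\Delta t>0$. Consider the ImEx2-ctr scheme together with periodic boundary conditions, and set $\tilde u_j^n=\sqrt{M_2}\,E_j^n+\sqrt{M_1}\,F_j^n$, $\tilde v_j^n=\sqrt{M_2}\,E_j^n-\sqrt{M_1}\,F_j^n$. If $$\Delta t\ \le\ \frac{\sigma\Delta x^2}{6}\cdot\frac{1+\sqrt{1+6\left(\frac{2\varepsilon}{\sigma\Delta x}\right)^2}}{2},$$ then the scheme is $l^2$-diminishing for the variables $\tilde u$ and $\tilde v$, that is, for every $n\ge0$, $$\sum_{j=1}^N\left((\tilde u_j^{n+1})^2+(\tilde v_j^{n+1})^2\right)\Delta x\ \le\ \sum_{j=1}^N\left((\tilde u_j^{n})^2+(\tilde v_j^{n})^2\right)\Delta x.$$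
   Context: The unknowns are real grid values $E_j^n,F_j^n$ with cells $1\le j\le N$ and time levels $n\ge0$; $\sigma$ is constant. With $s=\frac{\sigma\Delta t}{\varepsilon^2}$, put $$M_1=\frac{1}{1+\frac s2\left(1+\frac s2\right)},\quad M_1^+=\frac{1+\frac s2}{1+\frac s2\left(1+\frac s2\right)},\quad M_2=\frac{1+\frac s2}{1+s\left(1+\frac s2\right)},\quad M_2^+=\frac{1+s}{1+s\left(1+\frac s2\right)}.$$ The ImEx2-ctr scheme (for the hyperbolic heat equations $\partial_tE+\frac1\varepsilon\partial_xF=0$, $\partial_tF+\frac1\varepsilon\partial_xE=-\frac{\sigma}{\varepsilon^2}F$) is, for $1\le j\le N$, $n\ge0$, $$\frac{E_j^{n+1}-E_j^n}{\Delta t}+\frac{M_1}{\varepsilon}\frac{F_{j+1}^n-F_{j-1}^n}{2\Delta x}-\frac{M_1^+\Delta t}{2\varepsilon^2}\frac{E_{j+1}^n-2E_j^n+E_{j-1}^n}{\Delta x^2}=0,$$ $$\frac{F_j^{n+1}-F_j^n}{\Delta t}+\frac{M_2}{\varepsilon}\frac{E_{j+1}^n-E_{j-1}^n}{2\Delta x}-\frac{M_2^+\Delta t}{2\varepsilon^2}\frac{F_{j+1}^n-2F_j^n+F_{j-1}^n}{\Delta x^2}=-\frac{\sigma M_2}{\varepsilon^2}\,\frac{F_{j+1}^n+4F_j^n+F_{j-1}^n}{6}.$$ Periodic boundary conditions: at every time level, $E_0^n=E_N^n$, $F_0^n=F_N^n$, $E_{N+1}^n=E_1^n$, $F_{N+1}^n=F_1^n$.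 *)

theory Defs
  imports Complex_Main
begin

text \<open>
  A grid function has type \<^typ>\<open>nat \<Rightarrow> nat \<Rightarrow> real\<close>: \<open>E n j\<close> is the value in cell \<open>j\<close> at time
  level \<open>n\<close>.  The cells are \<open>1, \<dots>, N\<close>; the indices \<open>0\<close> and \<open>N + 1\<close> are ghost cells fixed by the
  boundary condition, and values at indices above \<open>N + 1\<close> are never used.  The term \<open>j - 1\<close> only
  occurs for \<open>j \<ge> 1\<close>, so the subtraction on \<^typ>\<open>nat\<close> does not truncate.
  The parameters \<open>\<sigma> \<epsilon> dx dt\<close> stand for sigma, epsilon, Delta x and Delta t.
\<close>

definition stiffness :: "real \<Rightarrow> real \<Rightarrow> real \<Rightarrow> real" where
  "stiffness \<sigma> \<epsilon> dt = \<sigma> * dt / \<epsilon>\<^sup>2"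

definition M1 :: "real \<Rightarrow> real" where
  "M1 s = 1 / (1 + s / 2 * (1 + s / 2))"

definition M1_plus :: "real \<Rightarrow> real" where
  "M1_plus s = (1 + s / 2) / (1 + s / 2 * (1 + s / 2))"

definition M2 :: "real \<Rightarrow> real" where
  "M2 s = (1 + s / 2) / (1 + s * (1 + s / 2))"

definition M2_plus :: "real \<Rightarrow> real" where
  "M2_plus s = (1 + s) / (1 + s * (1 + s / 2))"

definition ImEx2_ctr_scheme ::
  "real \<Rightarrow> real \<Rightarrow> real \<Rightarrow> real \<Rightarrow> nat \<Rightarrow> (nat \<Rightarrow> nat \<Rightarrow> real) \<Rightarrow> (nat \<Rightarrow> nat \<Rightarrow> real) \<Rightarrow> bool" where
  "ImEx2_ctr_scheme \<sigma> \<epsilon> dx dt N E F \<longleftrightarrow>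
    (let s = stiffness \<sigma> \<epsilon> dt in
      \<forall>n. \<forall>j\<in>{1..N}.
        (E (n + 1) j - E n j) / dt
          + M1 s / \<epsilon> * ((F n (j + 1) - F n (j - 1)) / (2 * dx))
          - M1_plus s * dt / (2 * \<epsilon>\<^sup>2) * ((E n (j + 1) - 2 * E n j + E n (j - 1)) / dx\<^sup>2)
        = 0 \<and>
        (F (n + 1) j - F n j) / dt
          + M2 s / \<epsilon> * ((E n (j + 1) - E n (j - 1)) / (2 * dx))
          - M2_plus s * dt / (2 * \<epsilon>\<^sup>2) * ((F n (j + 1) - 2 * F n j + F n (j - 1)) / dx\<^sup>2)
        = - (\<sigma> * M2 s / \<epsilon>\<^sup>2) * ((F n (j + 1) + 4 * F n j + F n (j - 1)) / 6))"

definition periodic_bc :: "nat \<Rightarrow> (nat \<Rightarrow> nat \<Rightarrow> real) \<Rightarrow> bool" where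
  "periodic_bc N X \<longleftrightarrow> (\<forall>n. X n 0 = X n N \<and> X n (N + 1) = X n 1)"

definition u_tilde ::
  "real \<Rightarrow> real \<Rightarrow> real \<Rightarrow> (nat \<Rightarrow> nat \<Rightarrow> real) \<Rightarrow> (nat \<Rightarrow> nat \<Rightarrow> real) \<Rightarrow> nat \<Rightarrow> nat \<Rightarrow> real" where
  "u_tilde \<sigma> \<epsilon> dt E F n j =
    (let s = stiffness \<sigma> \<epsilon> dt in sqrt (M2 s) * E n j + sqrt (M1 s) * F n j)"

definition v_tilde ::
  "real \<Rightarrow> real \<Rightarrow> real \<Rightarrow> (nat \<Rightarrow> nat \<Rightarrow> real) \<Rightarrow> (nat \<Rightarrow> nat \<Rightarrow> real) \<Rightarrow> nat \<Rightarrow> nat \<Rightarrow> real" where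
  "v_tilde \<sigma> \<epsilon> dt E F n j =
    (let s = stiffness \<sigma> \<epsilon> dt in sqrt (M2 s) * E n j - sqrt (M1 s) * F n j)"

definition l2_diminishing ::
  "real \<Rightarrow> nat \<Rightarrow> (nat \<Rightarrow> nat \<Rightarrow> real) \<Rightarrow> (nat \<Rightarrow> nat \<Rightarrow> real) \<Rightarrow> bool" where
  "l2_diminishing dx N U V \<longleftrightarrow>
    (\<forall>n. (\<Sum>j=1..N. ((U (n + 1) j)\<^sup>2 + (V (n + 1) j)\<^sup>2) * dx)
          \<le> (\<Sum>j=1..N. ((U n j)\<^sup>2 + (V n j)\<^sup>2) * dx))"

end

theory Submission
  imports Defs
begin

text \<open>
  Since \<open>u\<^sup>2 + v\<^sup>2 = 2 (M2 E\<^sup>2 + M1 F\<^sup>2)\<close>, the claim is a von Neumann analysis in a weighted norm.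
  By Parseval it suffices to treat one Fourier mode \<open>\<theta>\<close>, on which the scheme acts, for the
  symmetrised unknowns, by a matrix with diagonal \<open>A, B\<close> and both off-diagonal entries \<open>- \<i> \<beta>\<close>,
  with \<open>A, B, \<beta>\<close> real.  When \<open>A, B \<in> [-1, 1]\<close>, this matrix is a contraction iff
  \<open>\<beta>\<^sup>2 \<le> (1 - A) (1 + B)\<close> and \<open>\<beta>\<^sup>2 \<le> (1 + A) (1 - B)\<close>.  With \<open>y = sin\<^sup>2 (\<theta> / 2)\<close> and
  \<open>\<lambda> = dt / (\<epsilon> dx)\<close>, both follow from inequalities that are affine in \<open>y\<close>, once the step size
  restriction is rewritten as \<open>\<lambda>\<^sup>2 \<le> (1 + s) / 6\<close>.
\<close>

section \<open>Discrete Fourier transform and Parseval's identity\<close>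

text \<open>The sum runs over the cells only, so ghost values do not enter. There is no
  normalisation, hence the factor \<open>N\<close> in Parseval's identity.\<close>

definition dft :: "nat \<Rightarrow> nat \<Rightarrow> (nat \<Rightarrow> real) \<Rightarrow> complex" where
  "dft N k X = (\<Sum>j=1..N. of_real (X j) * cis (- (2 * pi * real k / real N * real j)))"

text \<open>Orthogonality of characters: for \<open>j\<close> different from \<open>l\<close> this
  is a geometric sum over an \<open>N\<close>-th root of unity other than 1.\<close>

lemma sum_cis_roots_of_unity:
  assumes "j \<in> {1..N}" "l \<in> {1..N}"
  shows "(\<Sum>k<N. cis (2 * pi * real k / real N * (real l - real j))) = (if j = l then of_nat N else 0)"
proof (cases "j = l")
  case False
  define t where "t = 2 * pi * (real l - real j) / real N"
  have N: "real N > 0" using assms by auto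
  have pow: "cis (2 * pi * real k / real N * (real l - real j)) = cis t ^ k" for k
    unfolding t_def by (simp add: Complex.DeMoivre mult_ac)
  have "cis t ^ N = cis (2 * pi * of_int (int l - int j))"
    using N by (simp add: t_def Complex.DeMoivre)
  then have one: "cis t ^ N = 1" by (metis cis_multiple_2pi Ints_of_int)
  \<comment> \<open>Otherwise \<open>N\<close> would divide \<open>l - j\<close>, which is nonzero
    and smaller than \<open>N\<close> in absolute value.\<close>
  have "cis t \<noteq> 1"
  proof
    assume "cis t = 1"
    then have "cos t = 1" by (simp add: complex_eq_iff)
    then obtain m :: int where "t = of_int m * 2 * pi"
      by (auto simp: cos_one_2pi_int)
    then have "2 * pi * (real l - real j) = 2 * pi * (of_int m * real N)"
      using N by (simp add: t_def field_simps)
    then have "real l - real j = of_int m * real N" by simp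
    then have eq: "int l - int j = m * int N"
      by (metis (mono_tags) of_int_eq_iff of_int_diff of_int_mult of_int_of_nat_eq)
    have "int N dvd int l - int j" by (simp add: eq)
    moreover have "int l - int j \<noteq> 0" using False by simp
    ultimately have "\<bar>int N\<bar> \<le> \<bar>int l - int j\<bar>" by (rule dvd_imp_le_int[rotated])
    then show False using assms by auto
  qed
  then show ?thesis unfolding pow using False one by (simp add: sum_gp_strict)
qed simp

text \<open>Expanding the squared modulus gives a double sum over cells; once the sum over modes is
  moved inside, orthogonality leaves only the diagonal.\<close>

lemma parseval_dft: "(\<Sum>k<N. (cmod (dft N k X))\<^sup>2) = real N * (\<Sum>j=1..N. (X j)\<^sup>2)"
proof -
  have "complex_of_real ((cmod (dft N k X))\<^sup>2) =
      (\<Sum>j=1..N. \<Sum>l=1..N. of_real (X j * X l) * cis (2 * pi * real k / real N * (real l - real j)))"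
    for k
    unfolding complex_norm_square dft_def cnj_sum sum_product
    by (intro sum.cong refl) (simp add: cis_cnj cis_mult algebra_simps diff_divide_distrib)
  then have "complex_of_real (\<Sum>k<N. (cmod (dft N k X))\<^sup>2) =
      (\<Sum>k<N. \<Sum>j=1..N. \<Sum>l=1..N.
         of_real (X j * X l) * cis (2 * pi * real k / real N * (real l - real j)))"
    by simp
  also have "\<dots> = (\<Sum>j=1..N. \<Sum>k<N. \<Sum>l=1..N.
         of_real (X j * X l) * cis (2 * pi * real k / real N * (real l - real j)))"
    by (rule sum.swap)
  also have "\<dots> = (\<Sum>j=1..N. \<Sum>l=1..N. \<Sum>k<N.
         of_real (X j * X l) * cis (2 * pi * real k / real N * (real l - real j)))"
    by (intro sum.cong refl sum.swap)
  also have "\<dots> = (\<Sum>j=1..N. \<Sum>l=1..N. of_real (X j * X l) * (if j = l then of_nat N else 0))"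
    unfolding sum_distrib_left[symmetric]
    by (intro sum.cong refl arg_cong2[where f = "(*)"] sum_cis_roots_of_unity)
  also have "\<dots> = (\<Sum>j=1..N. of_real (X j * X j) * of_nat N)"
    by (intro sum.cong refl) (simp add: if_distrib[of "\<lambda>x. _ * x"] sum.delta cong: if_cong)
  also have "\<dots> = complex_of_real (real N * (\<Sum>j=1..N. (X j)\<^sup>2))"
    by (simp add: sum_distrib_left power2_eq_square mult_ac)
  finally show ?thesis by (simp only: of_real_eq_iff)
qed

section \<open>Fourier symbols of periodic difference operators\<close>

lemma dft_add: "dft N k (\<lambda>j. X j + Y j) = dft N k X + dft N k Y"
  by (simp add: dft_def sum.distrib algebra_simps)

lemma dft_scale: "dft N k (\<lambda>j. c * X j) = of_real c * dft N k X"
  by (simp add: dft_def sum_distrib_left mult_ac)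

lemma dft_cong: "(\<And>j. j \<in> {1..N} \<Longrightarrow> X j = Y j) \<Longrightarrow> dft N k X = dft N k Y"
  by (simp add: dft_def)

text \<open>The difference of the two sums telescopes to \<open>f (Suc N) - f 1\<close>.\<close>

lemma sum_shift_periodic:
  fixes f :: "nat \<Rightarrow> 'a :: ab_group_add"
  assumes "f (Suc N) = f 1"
  shows "(\<Sum>j=1..N. f (Suc j)) = (\<Sum>j=1..N. f j)"
proof -
  have "(\<Sum>j=1..N. f (Suc j)) = (\<Sum>j=1..N. f (Suc j) - f j) + (\<Sum>j=1..N. f j)"
    by (simp add: sum_subtractf)
  then show ?thesis using assms by (simp add: sum_Suc_diff)
qed

text \<open>The phase of mode \<open>k\<close> has period \<open>N\<close>, so with the ghost value
  the whole summand agrees at \<open>N + 1\<close> and \<open>1\<close> and the sum can be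
  reindexed.\<close>

lemma dft_shift_up:
  assumes "N \<ge> 1" "X (N + 1) = X 1"
  shows "dft N k (\<lambda>j. X (j + 1)) = cis (2 * pi * real k / real N) * dft N k X"
proof -
  define t where "t = 2 * pi * real k / real N"
  define f where "f j = of_real (X j) * cis (- (t * real j))" for j
  have tN: "t * real N = 2 * pi * real k" using assms by (simp add: t_def)
  have "cis (- (t * real (Suc N))) = cis (- t) * cis (- (t * real N))"
    by (simp add: cis_mult algebra_simps)
  also have "cis (- (t * real N)) = 1"
    using cis_multiple_2pi[of "- real k"] by (simp add: tN)
  finally have "f (Suc N) = f 1" using assms by (simp add: f_def)
  have "dft N k (\<lambda>j. X (j + 1)) = (\<Sum>j=1..N. cis t * f (Suc j))"
    unfolding dft_def t_def[symmetric] f_def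
    by (intro sum.cong refl) (simp add: cis_mult algebra_simps)
  also have "\<dots> = cis t * (\<Sum>j=1..N. f j)"
    unfolding sum_distrib_left[symmetric] sum_shift_periodic[OF \<open>f (Suc N) = f 1\<close>] ..
  finally show ?thesis by (simp add: dft_def f_def t_def)
qed

lemma dft_shift_down:
  assumes "N \<ge> 1" "X 0 = X N"
  shows "dft N k (\<lambda>j. X (j - 1)) = cis (- (2 * pi * real k / real N)) * dft N k X"
proof -
  define t where "t = 2 * pi * real k / real N"
  \<comment> \<open>The upward shift applies to the lowered function, whose values at
    \<open>N + 1\<close> and \<open>1\<close> are \<open>X N\<close> and \<open>X 0\<close>.\<close>
  have "dft N k X = dft N k (\<lambda>j. (\<lambda>i. X (i - 1)) (j + 1))" by simp
  also have "\<dots> = cis t * dft N k (\<lambda>j. X (j - 1))"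
    unfolding t_def using assms by (intro dft_shift_up) auto
  finally have "cis (- t) * dft N k X = cis (- t) * cis t * dft N k (\<lambda>j. X (j - 1))"
    by (simp add: mult.assoc)
  then show ?thesis by (simp add: cis_mult t_def)
qed

text \<open>Common form of both scheme equations, with the roles of \<open>X\<close> and
  \<open>Y\<close> exchanged. On a mode, the second difference acts as -2 (1 - cos \<theta>) and the
  centred difference as 2 i sin \<theta>.\<close>

lemma dft_update:
  assumes N: "N \<ge> 1"
    and X: "X 0 = X N" "X (N + 1) = X 1" and Y: "Y 0 = Y N" "Y (N + 1) = Y 1"
    and Z: "\<And>j. j \<in> {1..N} \<Longrightarrow>
      Z j = a * X j + b * (X (j + 1) - 2 * X j + X (j - 1)) - c / 2 * (Y (j + 1) - Y (j - 1))"
  defines "\<theta> \<equiv> \<lambda>k. 2 * pi * real k / real N"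
  shows "dft N k Z = of_real (a - 2 * b * (1 - cos (\<theta> k))) * dft N k X
    - \<i> * of_real (c * sin (\<theta> k)) * dft N k Y"
proof -
  have "dft N k Z = dft N k (\<lambda>j. (a - 2 * b) * X j + (b * X (j + 1) + (b * X (j - 1)
      + ((- c / 2) * Y (j + 1) + (c / 2) * Y (j - 1)))))"
    by (rule dft_cong) (simp add: Z field_simps)
  also have "\<dots> = of_real (a - 2 * b) * dft N k X + (of_real b * (cis (\<theta> k) * dft N k X)
      + (of_real b * (cis (- \<theta> k) * dft N k X) + (of_real (- c / 2) * (cis (\<theta> k) * dft N k Y)
      + of_real (c / 2) * (cis (- \<theta> k) * dft N k Y))))"
    unfolding dft_add dft_scale dft_shift_up[of N X, OF N X(2)] dft_shift_up[of N Y, OF N Y(2)]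
      dft_shift_down[of N X, OF N X(1)] dft_shift_down[of N Y, OF N Y(1)] \<theta>_def ..
  also have "\<dots> = of_real (a - 2 * b * (1 - cos (\<theta> k))) * dft N k X
    - \<i> * of_real (c * sin (\<theta> k)) * dft N k Y"
    by (simp add: complex_eq_iff field_simps)
  finally show ?thesis .
qed

section \<open>Contraction criterion for a weighted 2x2 symbol\<close>

text \<open>The energy loss is a Hermitian form in \<open>x\<close> and \<open>y\<close>. It is
  nonnegative because, after scaling by the weights, its diagonal entries \<open>P\<close>,
  \<open>Q\<close> have nonnegative sum and its determinant
  \<open>P * Q - \<beta> * (A - B)\<^sup>2\<close> is nonnegative.\<close>

lemma symbol_contraction:
  fixes A B g p q :: real and x y :: complex
  assumes pq: "p \<ge> 0" "q \<ge> 0" and A: "\<bar>A\<bar> \<le> 1" and B: "\<bar>B\<bar> \<le> 1"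
    and c1: "p * q * g\<^sup>2 \<le> (1 - A) * (1 + B)" and c2: "p * q * g\<^sup>2 \<le> (1 + A) * (1 - B)"
  shows "p * (cmod (of_real A * x - \<i> * of_real (q * g) * y))\<^sup>2
      + q * (cmod (of_real B * y - \<i> * of_real (p * g) * x))\<^sup>2
    \<le> p * (cmod x)\<^sup>2 + q * (cmod y)\<^sup>2"
proof -
  \<comment> \<open>This is the square of the symmetrised off-diagonal entry.\<close>
  define \<beta> where "\<beta> = p * q * g\<^sup>2"
  define P where "P = 1 - A\<^sup>2 - \<beta>"
  define Q where "Q = 1 - B\<^sup>2 - \<beta>"
  \<comment> \<open>\<open>m\<close> is the imaginary part of \<open>cnj x * y\<close>, and
    \<open>d\<close> is the cross term of the energy loss.\<close>
  define m where "m = Re x * Im y - Im x * Re y"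
  define d where "d = 2 * p * q * g * (A - B) * m"
  have "\<beta> \<ge> 0" using pq by (simp add: \<beta>_def)
  \<comment> \<open>\<open>c1\<close> and \<open>c2\<close> are exactly the two signs of this bound,
    which controls both the determinant and the trace.\<close>
  have ab: "\<bar>A - B\<bar> \<le> 1 - A * B - \<beta>"
    using c1 c2 by (simp add: \<beta>_def abs_le_iff algebra_simps)
  have "P * Q - \<beta> * (A - B)\<^sup>2 = (1 - A * B - \<beta>)\<^sup>2 - (A - B)\<^sup>2"
    by (simp add: P_def Q_def power2_eq_square algebra_simps)
  also have "\<dots> \<ge> 0" using power_mono[OF ab, of 2] by simp
  finally have PQ: "\<beta> * (A - B)\<^sup>2 \<le> P * Q" by simp
  then have PQ0: "0 \<le> P * Q" using \<open>\<beta> \<ge> 0\<close> by (smt (verit) mult_nonneg_nonneg zero_le_power2)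
  \<comment> \<open>The trace \<open>P + Q\<close> equals 2 (1 - A B - \<beta>) - (A - B)^2.\<close>
  have "(A - B)\<^sup>2 = \<bar>A - B\<bar> * \<bar>A - B\<bar>" by (simp add: power2_eq_square)
  also have "\<dots> \<le> 2 * \<bar>A - B\<bar>" using A B by (intro mult_right_mono) auto
  finally have "P + Q \<ge> 0" using ab by (simp add: P_def Q_def power2_eq_square algebra_simps)
  with PQ0 have P: "P \<ge> 0" and Q: "Q \<ge> 0"
    by (auto simp: zero_le_mult_iff)
  have m: "m\<^sup>2 \<le> (cmod x)\<^sup>2 * (cmod y)\<^sup>2"
  proof -
    have "(cmod x)\<^sup>2 * (cmod y)\<^sup>2 - m\<^sup>2 = (Re x * Re y + Im x * Im y)\<^sup>2"
      unfolding m_def cmod_power2 by (simp add: power2_eq_square algebra_simps)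
    then show ?thesis by (smt (verit) zero_le_power2)
  qed
  define X where "X = P * (p * (cmod x)\<^sup>2)"
  define Y where "Y = Q * (q * (cmod y)\<^sup>2)"
  have X: "X \<ge> 0" and Y: "Y \<ge> 0" using P Q pq by (simp_all add: X_def Y_def)
  have "d\<^sup>2 = 4 * (\<beta> * (A - B)\<^sup>2) * (p * q) * m\<^sup>2"
    by (simp add: d_def \<beta>_def power2_eq_square algebra_simps)
  also have "\<dots> \<le> 4 * (P * Q) * (p * q) * ((cmod x)\<^sup>2 * (cmod y)\<^sup>2)"
  proof -
    have "\<beta> * (A - B)\<^sup>2 * (p * q) * m\<^sup>2 \<le> P * Q * (p * q) * ((cmod x)\<^sup>2 * (cmod y)\<^sup>2)"
      by (rule mult_mono[OF mult_right_mono[OF PQ] m]) (use pq PQ0 in auto)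
    then show ?thesis by (simp add: mult.assoc)
  qed
  also have "\<dots> = 4 * X * Y" by (simp add: X_def Y_def)
  \<comment> \<open>The arithmetic-geometric mean inequality, kept in squared form to avoid square
    roots of \<open>X\<close> and \<open>Y\<close>.\<close>
  also have "\<dots> \<le> (X + Y)\<^sup>2"
    using zero_le_power2[of "X - Y"] by (simp add: power2_eq_square algebra_simps)
  finally have "d \<le> X + Y" by (rule power2_le_imp_le) (use X Y in simp)
  moreover have "p * (cmod x)\<^sup>2 + q * (cmod y)\<^sup>2
      - (p * (cmod (of_real A * x - \<i> * of_real (q * g) * y))\<^sup>2
      + q * (cmod (of_real B * y - \<i> * of_real (p * g) * x))\<^sup>2) = X + Y - d"
    unfolding X_def Y_def P_def Q_def d_def m_def \<beta>_def cmod_power2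
    by (simp add: power2_eq_square algebra_simps)
  ultimately show ?thesis by linarith
qed

section \<open>Bounds on the symbol of the scheme\<close>

lemma affine_nonneg_on_unit:
  fixes a b y :: real
  assumes "0 \<le> a" "0 \<le> a + b" "0 \<le> y" "y \<le> 1"
  shows "0 \<le> a + b * y"
proof -
  have "a + b * y = (1 - y) * a + y * (a + b)" by (simp add: algebra_simps)
  then show ?thesis using assms by simp
qed

text \<open>\<open>L\<close> stands for \<lambda>^2; \<open>A\<close>, \<open>B\<close> are the
  diagonal symbols from \<open>dft_update\<close>, and \<open>4 * L * y * (1 - y)\<close> is
  \<lambda>^2 sin^2 \<theta>. Clearing \<open>d1 * d2\<close> and cancelling a multiple of
  \<open>L * y\<close> reduces the last two bounds to \<open>k3\<close> and \<open>k4\<close>, whose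
  two sides differ by a function affine in \<open>y\<close>.\<close>

lemma ImEx2_symbol_bounds:
  fixes s L y :: real
  assumes s: "s > 0" and L: "0 \<le> L" "L \<le> (1 + s) / 6" and y: "0 \<le> y" "y \<le> 1"
  defines "A \<equiv> 1 - 2 * M1_plus s * L * y"
    and "B \<equiv> 1 - s * M2 s - 4 * (M2_plus s * L / 2 - s * M2 s / 6) * y"
  shows "\<bar>A\<bar> \<le> 1" "\<bar>B\<bar> \<le> 1"
    and "M2 s * M1 s * (4 * L * y * (1 - y)) \<le> (1 - A) * (1 + B)"
    and "M2 s * M1 s * (4 * L * y * (1 - y)) \<le> (1 + A) * (1 - B)"
proof -
  define q where "q = 1 + s / 2"
  define d1 where "d1 = 1 + s / 2 * q"
  define d2 where "d2 = 1 + s * q"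
  have q: "q > 0" using s by (simp add: q_def)
  have d1: "d1 > 0" and d2: "d2 > 0" using s q by (simp_all add: d1_def d2_def add_pos_pos)
  have M: "M1 s = 1 / d1" "M1_plus s = q / d1" "M2 s = q / d2" "M2_plus s = (1 + s) / d2"
    by (simp_all add: M1_def M1_plus_def M2_def M2_plus_def q_def d1_def d2_def)
  have A1: "1 - A = 2 * q * L * y / d1" by (simp add: A_def M)
  have A2: "1 + A = 2 * (d1 - q * L * y) / d1" using d1 by (simp add: A_def M field_simps)
  have B1: "1 - B = (s * q * (1 - 2 / 3 * y) + 2 * (1 + s) * L * y) / d2"
    using d2 by (simp add: B_def M field_simps)
  have B2: "1 + B = (2 * d2 - (s * q * (1 - 2 / 3 * y) + 2 * (1 + s) * L * y)) / d2"
    using d2 by (simp add: B_def M field_simps)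
  have sq: "s * q = s + s\<^sup>2 / 2" by (simp add: q_def power2_eq_square algebra_simps)
  have qL: "q * L \<le> q * ((1 + s) / 6)" using L q by (intro mult_left_mono) auto
  have sL: "(1 + s) * L \<le> (1 + s) * ((1 + s) / 6)" using L s by (intro mult_left_mono) auto
  have s2: "0 \<le> s\<^sup>2" by simp
  have sL': "(1 + s) * L \<le> 1 / 6 + s / 3 + s\<^sup>2 / 6"
    using sL by (simp add: power2_eq_square algebra_simps)
  have qL': "q * L \<le> 1 / 6 + s / 4 + s\<^sup>2 / 12"
    using qL by (simp add: q_def power2_eq_square field_simps)
  have d1': "d1 = 1 + s / 2 + s\<^sup>2 / 4" by (simp add: d1_def q_def power2_eq_square algebra_simps)
  have d2': "d2 = 1 + s + s\<^sup>2 / 2" by (simp add: d2_def sq)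
  have k1: "0 \<le> d1 - q * L * y"
    using affine_nonneg_on_unit[of d1 "- (q * L)" y] y d1 qL' s s2 by (simp add: d1')
  have k2: "0 \<le> s * q * (1 - 2 / 3 * y) + 2 * (1 + s) * L * y"
    using s q L y by (intro add_nonneg_nonneg mult_nonneg_nonneg) auto
  have k3: "2 * q * (1 - y) \<le> q * (2 * d2 - (s * q * (1 - 2 / 3 * y) + 2 * (1 + s) * L * y))"
  proof -
    \<comment> \<open>At \<open>y = 0\<close> the value is \<open>s * q\<close>; at
      \<open>y = 1\<close> the bound \<open>sL'\<close> on \<open>(1 + s) * L\<close>
      decides.\<close>
    have "0 \<le> s * q + (2 + 2 / 3 * (s * q) - 2 * ((1 + s) * L)) * y"
    proof (rule affine_nonneg_on_unit)
      show "0 \<le> s * q" using s q by simp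
      show "0 \<le> s * q + (2 + 2 / 3 * (s * q) - 2 * ((1 + s) * L))"
        using s s2 sL' unfolding sq distrib_left by linarith
    qed (use y in auto)
    also have "\<dots> = 2 * d2 - (s * q * (1 - 2 / 3 * y) + 2 * (1 + s) * L * y) - 2 * (1 - y)"
      by (simp add: d2_def algebra_simps)
    finally have "2 * (1 - y) \<le> 2 * d2 - (s * q * (1 - 2 / 3 * y) + 2 * (1 + s) * L * y)" by simp
    from mult_left_mono[OF this, of q] q show ?thesis by (simp add: mult_ac)
  qed
  have k4: "q * (1 - y) \<le> (d1 - q * L * y) * (1 + s)"
  proof -
    \<comment> \<open>At \<open>y = 1\<close> this function equals
      \<open>(d1 - q * L) * (1 + s)\<close>.\<close>
    have "0 \<le> (d1 * (1 + s) - q) + (q - q * L * (1 + s)) * y"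
    proof (intro affine_nonneg_on_unit)
      have "d1 * (1 + s) - q = s + 3 / 4 * s\<^sup>2 + s ^ 3 / 4"
        by (simp add: d1' q_def power2_eq_square power3_eq_cube field_simps)
      then show "0 \<le> d1 * (1 + s) - q" using s by simp
      have "0 \<le> d1 - q * L" unfolding d1' using qL' s s2 by linarith
      then have "0 \<le> (d1 - q * L) * (1 + s)" using s by simp
      then show "0 \<le> d1 * (1 + s) - q + (q - q * L * (1 + s))" by (simp add: algebra_simps)
    qed (use y in auto)
    then show ?thesis by (simp add: algebra_simps)
  qed
  have k5: "0 \<le> 2 * d2 - (s * q * (1 - 2 / 3 * y) + 2 * (1 + s) * L * y)"
  proof -
    have "0 \<le> 2 * q * (1 - y)" using q y by simp
    with k3 have "0 \<le> q * (2 * d2 - (s * q * (1 - 2 / 3 * y) + 2 * (1 + s) * L * y))" by linarith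
    then show ?thesis using q by (simp only: zero_le_mult_iff) auto
  qed
  have "0 \<le> 1 - A" using q L y d1 by (simp add: A1)
  moreover have "0 \<le> 1 + A" using k1 d1 by (simp add: A2)
  ultimately show "\<bar>A\<bar> \<le> 1" by auto
  have "0 \<le> 1 - B" unfolding B1 using k2 d2 by (intro divide_nonneg_pos) auto
  moreover have "0 \<le> 1 + B" unfolding B2 using k5 d2 by (intro divide_nonneg_pos) auto
  ultimately show "\<bar>B\<bar> \<le> 1" by auto
  have lhs: "M2 s * M1 s * (4 * L * y * (1 - y)) = (2 * L * y * (2 * q * (1 - y))) / (d1 * d2)"
    by (simp add: M mult_ac)
  have "2 * L * y * (2 * q * (1 - y))
      \<le> 2 * L * y * (q * (2 * d2 - (s * q * (1 - 2 / 3 * y) + 2 * (1 + s) * L * y)))"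
    using L y by (intro mult_left_mono k3) auto
  then show "M2 s * M1 s * (4 * L * y * (1 - y)) \<le> (1 - A) * (1 + B)"
    unfolding lhs A1 B2 times_divide_times_eq using d1 d2
    by (intro divide_right_mono) (auto simp: mult_ac)
  have "2 * L * y * (2 * q * (1 - y)) = 4 * L * y * (q * (1 - y))" by simp
  also have "\<dots> \<le> 4 * L * y * ((d1 - q * L * y) * (1 + s))"
    using L y by (intro mult_left_mono k4) auto
  also have "\<dots> = 2 * (d1 - q * L * y) * (2 * (1 + s) * L * y)" by (simp add: algebra_simps)
  \<comment> \<open>The added damping term is nonnegative, and \<open>k1\<close> gives the sign of
    the factor in front.\<close>
  also have "\<dots> \<le> 2 * (d1 - q * L * y) * (s * q * (1 - 2 / 3 * y) + 2 * (1 + s) * L * y)"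
    using k1 s q y by (intro mult_left_mono) auto
  finally show "M2 s * M1 s * (4 * L * y * (1 - y)) \<le> (1 + A) * (1 - B)"
    unfolding lhs A2 B1 times_divide_times_eq using d1 d2 by (intro divide_right_mono) auto
qed

text \<open>The bound on \<open>dt\<close> is the positive root of \<open>z\<^sup>2 = p z + \<epsilon>\<^sup>2 dx\<^sup>2 / 6\<close> with \<open>p = \<sigma> dx\<^sup>2 / 6\<close>.\<close>

lemma step_size_bound:
  fixes \<sigma> \<epsilon> dx dt :: real
  assumes pos: "\<sigma> > 0" "\<epsilon> > 0" "dx > 0" "dt > 0"
    and dt: "dt \<le> \<sigma> * dx\<^sup>2 / 6 * ((1 + sqrt (1 + 6 * (2 * \<epsilon> / (\<sigma> * dx))\<^sup>2)) / 2)"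
  shows "(dt / (\<epsilon> * dx))\<^sup>2 \<le> (1 + stiffness \<sigma> \<epsilon> dt) / 6"
proof -
  define p where "p = \<sigma> * dx\<^sup>2 / 6"
  define r where "r = sqrt (1 + 6 * (2 * \<epsilon> / (\<sigma> * dx))\<^sup>2)"
  have r2: "r\<^sup>2 = 1 + 6 * (2 * \<epsilon> / (\<sigma> * dx))\<^sup>2" by (simp add: r_def)
  have p: "p > 0" using pos by (simp add: p_def)
  have r: "1 \<le> r" by (simp add: r_def)
  have "2 * dt - p \<le> p * r" using dt by (simp add: p_def r_def algebra_simps)
  \<comment> \<open>The lower bound comes from \<open>r \<ge> 1\<close> and \<open>dt > 0\<close>; a
    two-sided bound is needed for squaring.\<close>
  moreover have "- (2 * dt - p) \<le> p * r"
    using mult_left_mono[OF r, of p] p pos by linarith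
  ultimately have "\<bar>2 * dt - p\<bar> \<le> p * r" by linarith
  from power_mono[OF this, of 2] have "(2 * dt - p)\<^sup>2 \<le> p\<^sup>2 * r\<^sup>2"
    by (simp add: power_mult_distrib)
  also have "\<dots> = p\<^sup>2 + 2 / 3 * (\<epsilon>\<^sup>2 * dx\<^sup>2)"
    using pos unfolding r2 p_def by (simp add: power2_eq_square field_simps)
  finally have "4 * dt\<^sup>2 \<le> 4 * (p * dt) + 2 / 3 * (\<epsilon>\<^sup>2 * dx\<^sup>2)"
    by (simp add: power2_eq_square algebra_simps)
  then show ?thesis
    using pos by (simp add: p_def stiffness_def power_divide power_mult_distrib field_simps)
qed

section \<open>Explicit update and summation over modes\<close>

text \<open>The scheme solved for the new time level in the shape required by
  \<open>dft_update\<close>; the factor \<open>1\<close> plays the part of \<open>a\<close>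
  there.\<close>

lemma ImEx2_ctr_schemeD:
  assumes pos: "\<epsilon> > 0" "dx > 0" "dt > 0"
    and sch: "ImEx2_ctr_scheme \<sigma> \<epsilon> dx dt N E F" and j: "j \<in> {1..N}"
  defines "s \<equiv> stiffness \<sigma> \<epsilon> dt" and "l \<equiv> dt / (\<epsilon> * dx)"
  shows "E (n + 1) j = 1 * E n j + (M1_plus s * l\<^sup>2 / 2) * (E n (j + 1) - 2 * E n j + E n (j - 1))
      - (M1 s * l) / 2 * (F n (j + 1) - F n (j - 1))" (is ?E)
    and "F (n + 1) j = (1 - s * M2 s) * F n j
      + (M2_plus s * l\<^sup>2 / 2 - s * M2 s / 6) * (F n (j + 1) - 2 * F n j + F n (j - 1))
      - (M2 s * l) / 2 * (E n (j + 1) - E n (j - 1))" (is ?F)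
proof -
  have cancel: "x = dt * z" if "x / dt = z" for x z using that pos by auto
  define m1 m1p m2 m2p where "m1 = M1 s" "m1p = M1_plus s" "m2 = M2 s" "m2p = M2_plus s"
  note ms = this
  define D1 D2 G1 G2 where "D1 = F n (j + 1) - F n (j - 1)"
    and "D2 = E n (j + 1) - 2 * E n j + E n (j - 1)"
    and "G1 = E n (j + 1) - E n (j - 1)"
    and "G2 = F n (j + 1) - 2 * F n j + F n (j - 1)"
  note ds = this
  \<comment> \<open>The averaged source is \<open>F n j\<close> plus a sixth of the second
    difference, so it splits into pure damping and a correction of the diffusion
    coefficient.\<close>
  have G2: "F n (j + 1) + 4 * F n j + F n (j - 1) = G2 + 6 * F n j" by (simp add: ds)
  have "(E (n + 1) j - E n j) / dt + m1 / \<epsilon> * (D1 / (2 * dx))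
      - m1p * dt / (2 * \<epsilon>\<^sup>2) * (D2 / dx\<^sup>2) = 0"
    and "(F (n + 1) j - F n j) / dt + m2 / \<epsilon> * (G1 / (2 * dx))
      - m2p * dt / (2 * \<epsilon>\<^sup>2) * (G2 / dx\<^sup>2) = - (\<sigma> * m2 / \<epsilon>\<^sup>2) * ((G2 + 6 * F n j) / 6)"
    using sch j unfolding ImEx2_ctr_scheme_def Let_def s_def[symmetric] ms[symmetric]
    by (simp_all only: G2[symmetric] ds) auto
  then have "(E (n + 1) j - E n j) / dt = m1p * dt / (2 * \<epsilon>\<^sup>2) * (D2 / dx\<^sup>2)
      - m1 / \<epsilon> * (D1 / (2 * dx))"
    and "(F (n + 1) j - F n j) / dt = m2p * dt / (2 * \<epsilon>\<^sup>2) * (G2 / dx\<^sup>2)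
      - m2 / \<epsilon> * (G1 / (2 * dx)) - (\<sigma> * m2 / \<epsilon>\<^sup>2) * ((G2 + 6 * F n j) / 6)"
    by linarith+
  note eqs = this[THEN cancel]
  have "E (n + 1) j - E n j = (m1p * l\<^sup>2 / 2) * D2 - (m1 * l) / 2 * D1"
    unfolding eqs
    by (simp add: l_def power_divide power_mult_distrib power2_eq_square algebra_simps)
  then show ?E unfolding ms[symmetric] ds[symmetric] by linarith
  have "F (n + 1) j - F n j
      = (m2p * l\<^sup>2 / 2 - s * m2 / 6) * G2 - s * m2 * F n j - (m2 * l) / 2 * G1"
    unfolding eqs
    by (simp add: l_def s_def stiffness_def power_divide power_mult_distrib power2_eq_square
        algebra_simps)
  then show ?F unfolding ms[symmetric] ds[symmetric] by (simp add: algebra_simps)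
qed

theorem theorem5p3:
  fixes \<sigma> \<epsilon> dx dt :: real
    and N :: nat
    and E F :: "nat \<Rightarrow> nat \<Rightarrow> real"
  assumes "\<sigma> > 0" and "\<epsilon> > 0" and "dx > 0" and "dt > 0"
    and "N \<ge> 1"
    and "ImEx2_ctr_scheme \<sigma> \<epsilon> dx dt N E F"
    and "periodic_bc N E" and "periodic_bc N F"
    and "dt \<le> \<sigma> * dx\<^sup>2 / 6 * ((1 + sqrt (1 + 6 * (2 * \<epsilon> / (\<sigma> * dx))\<^sup>2)) / 2)"
  shows "l2_diminishing dx N (u_tilde \<sigma> \<epsilon> dt E F) (v_tilde \<sigma> \<epsilon> dt E F)"
proof -
  define s where "s = stiffness \<sigma> \<epsilon> dt"
  define l where "l = dt / (\<epsilon> * dx)"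
  have s: "s > 0" using assms by (simp add: s_def stiffness_def)
  have L: "l\<^sup>2 \<le> (1 + s) / 6" unfolding s_def l_def by (rule step_size_bound) fact+
  have M: "M1 s \<ge> 0" "M2 s \<ge> 0" using s by (simp_all add: M1_def M2_def)
  have bcE: "E n 0 = E n N" "E n (N + 1) = E n 1" and bcF: "F n 0 = F n N" "F n (N + 1) = F n 1"
    for n using assms by (auto simp: periodic_bc_def)
  \<comment> \<open>The cross terms of \<open>u_tilde\<close> and \<open>v_tilde\<close> cancel,
    leaving the weighted energy.\<close>
  have energy: "(\<Sum>j=1..N. ((u_tilde \<sigma> \<epsilon> dt E F n j)\<^sup>2 + (v_tilde \<sigma> \<epsilon> dt E F n j)\<^sup>2) * dx)
      = 2 * dx * (M2 s * (\<Sum>j=1..N. (E n j)\<^sup>2) + M1 s * (\<Sum>j=1..N. (F n j)\<^sup>2))" for n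
  proof -
    have "(u_tilde \<sigma> \<epsilon> dt E F n j)\<^sup>2 + (v_tilde \<sigma> \<epsilon> dt E F n j)\<^sup>2
        = 2 * ((sqrt (M2 s))\<^sup>2 * (E n j)\<^sup>2 + (sqrt (M1 s))\<^sup>2 * (F n j)\<^sup>2)" for j
      unfolding u_tilde_def v_tilde_def Let_def s_def[symmetric]
      by (simp only: power2_eq_square) algebra
    then show ?thesis
      using M by (simp add: sum.distrib sum_distrib_left algebra_simps)
  qed
  have "M2 s * (\<Sum>j=1..N. (E (n + 1) j)\<^sup>2) + M1 s * (\<Sum>j=1..N. (F (n + 1) j)\<^sup>2)
      \<le> M2 s * (\<Sum>j=1..N. (E n j)\<^sup>2) + M1 s * (\<Sum>j=1..N. (F n j)\<^sup>2)" for n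
  proof -
    \<comment> \<open>The weights \<open>M2 s\<close> and \<open>M1 s\<close> balance the couplings
      \<open>M1 s\<close> in the \<open>E\<close> equation and \<open>M2 s\<close> in the
      \<open>F\<close> equation, as \<open>symbol_contraction\<close> requires.\<close>
    have mode: "M2 s * (cmod (dft N k (E (n + 1))))\<^sup>2 + M1 s * (cmod (dft N k (F (n + 1))))\<^sup>2
        \<le> M2 s * (cmod (dft N k (E n)))\<^sup>2 + M1 s * (cmod (dft N k (F n)))\<^sup>2" for k
    proof -
      define \<theta> where "\<theta> = 2 * pi * real k / real N"
      define y where "y = (1 - cos \<theta>) / 2"
      have y: "0 \<le> y" "y \<le> 1" using cos_ge_minus_one[of \<theta>] by (simp_all add: y_def)
      have "(sin \<theta>)\<^sup>2 = 4 * y * (1 - y)"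
        unfolding y_def sin_squared_eq by (simp add: power2_eq_square field_simps)
      then have g: "(l * sin \<theta>)\<^sup>2 = 4 * l\<^sup>2 * y * (1 - y)" by (simp add: power_mult_distrib)
      define A where "A = 1 - 2 * M1_plus s * l\<^sup>2 * y"
      define B where "B = 1 - s * M2 s - 4 * (M2_plus s * l\<^sup>2 / 2 - s * M2 s / 6) * y"
      note update = ImEx2_ctr_schemeD[OF assms(2-4,6), folded s_def l_def]
      have hE: "dft N k (E (n + 1)) = of_real A * dft N k (E n)
          - \<i> * of_real (M1 s * (l * sin \<theta>)) * dft N k (F n)"
        using dft_update[where X = "E n" and Y = "F n" and k = k, OF \<open>N \<ge> 1\<close> bcE bcF update(1),
            folded \<theta>_def]
        by (simp add: A_def y_def mult_ac)
      have hF: "dft N k (F (n + 1)) = of_real B * dft N k (F n)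
          - \<i> * of_real (M2 s * (l * sin \<theta>)) * dft N k (E n)"
        using dft_update[where X = "F n" and Y = "E n" and k = k, OF \<open>N \<ge> 1\<close> bcF bcE update(2),
            folded \<theta>_def]
        by (simp add: B_def y_def mult_ac)
      show ?thesis
        unfolding hE hF
        using ImEx2_symbol_bounds[OF s zero_le_power2 L y, folded A_def B_def] M
        by (intro symbol_contraction) (auto simp: g)
    qed
    \<comment> \<open>Parseval's identity turns the sum of the modewise bounds into \<open>N\<close>
      times the claim, and \<open>N\<close> is positive.\<close>
    have "real N * (M2 s * (\<Sum>j=1..N. (E (n + 1) j)\<^sup>2) + M1 s * (\<Sum>j=1..N. (F (n + 1) j)\<^sup>2))
        = (\<Sum>k<N. M2 s * (cmod (dft N k (E (n + 1))))\<^sup>2 + M1 s * (cmod (dft N k (F (n + 1))))\<^sup>2)"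
      by (simp only: sum.distrib sum_distrib_left[symmetric] parseval_dft) (simp add: algebra_simps)
    also have "\<dots> \<le> (\<Sum>k<N. M2 s * (cmod (dft N k (E n)))\<^sup>2 + M1 s * (cmod (dft N k (F n)))\<^sup>2)"
      by (intro sum_mono mode)
    also have "\<dots> = real N * (M2 s * (\<Sum>j=1..N. (E n j)\<^sup>2) + M1 s * (\<Sum>j=1..N. (F n j)\<^sup>2))"
      by (simp only: sum.distrib sum_distrib_left[symmetric] parseval_dft) (simp add: algebra_simps)
    finally show ?thesis using \<open>N \<ge> 1\<close> by simp
  qed
  then show ?thesis
    unfolding l2_diminishing_def energy using \<open>dx > 0\<close> by (intro allI mult_left_mono) auto
qed

end
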